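(* Let $(X,\Sigma,\mu)$ be a complete $\sigma$-finite measure space, let $\varphi:X\to X$ be a non-singular measurable transformation, let $h=\frac{d\mu\circ\varphi^{-1}}{d\mu}$, let $1\le p<\infty$, let $d\nu=(1+h)\,d\mu$, and let $C_\varphi:\mathcal{D}(C_\varphi)\subseteq L^p(\mu)\to L^p(\mu)$, $C_\varphi(f)=f\circ\varphi$, be the composition operator. Then the following statements are equivalent: (1) $C_\varphi$ is densely defined on $L^p(\mu)$; (2) $h<\infty$ $\mu$-a.e.; (3) $\mu_h$ is $\sigma$-finite. In particular, if $h<\infty$ $\mu$-a.e., then $$\overline{L^p(\nu)}^{\|\cdot\|_p}=\overline{\mathcal{D}(C_\varphi)}^{\|\cdot\|_p}=L^p(\mu),$$ where the closures are taken in $L^p(\mu)$.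
   Context: Functions are real-valued, and identified when equal $\mu$-a.e. A measurable transformation $\varphi:X\to X$ is non-singular if $\varphi^{-1}(F)\in\Sigma$ for all $F\in\Sigma$ and $\mu(\varphi^{-1}(F))=0$ whenever $\mu(F)=0$. The function $h:X\to[0,\infty]$ is the Radon–Nikodym derivative satisfying $\mu(\varphi^{-1}(A))=\int_A h\,d\mu$ for all $A\in\Sigma$. The measure $\mu_h:\Sigma\to[0,\infty]$ is $\mu_h(A)=\int_A h\,d\mu$. The domain is $\mathcal{D}(C_\varphi)=\{f\in L^p(\mu):\int_X|f\circ\varphi|^p\,d\mu<\infty\}$, and $C_\varphi$ is densely defined if $\mathcal{D}(C_\varphi)$ is dense in $L^p(\mu)$. *)

theory Defs
  imports "HOL-Analysis.Analysis"
begin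

definition ae_eq :: "'a measure \<Rightarrow> (('a \<Rightarrow> real) \<times> ('a \<Rightarrow> real)) set" where
  "ae_eq M = {(f, g). f \<in> borel_measurable M \<and> g \<in> borel_measurable M \<and> (AE x in M. f x = g x)}"

definition Lp_fun :: "'a measure \<Rightarrow> real \<Rightarrow> ('a \<Rightarrow> real) set" where
  "Lp_fun M p = {f \<in> borel_measurable M. (\<integral>\<^sup>+ x. ennreal (\<bar>f x\<bar> powr p) \<partial>M) < \<infinity>}"

text \<open>Only meaningful for \<open>f \<in> Lp_fun M p\<close>; otherwise the Bochner integral defaults to \<open>0\<close>.\<close>

definition Lp_norm :: "'a measure \<Rightarrow> real \<Rightarrow> ('a \<Rightarrow> real) \<Rightarrow> real" where
  "Lp_norm M p f = (\<integral>x. \<bar>f x\<bar> powr p \<partial>M) powr (1 / p)"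

definition Lp :: "'a measure \<Rightarrow> real \<Rightarrow> ('a \<Rightarrow> real) set set" where
  "Lp M p = Lp_fun M p // ae_eq M"

text \<open>The choice of representatives is immaterial, see \<open>Lp_dist_eq\<close> below.\<close>

definition Lp_dist :: "'a measure \<Rightarrow> real \<Rightarrow> ('a \<Rightarrow> real) set \<Rightarrow> ('a \<Rightarrow> real) set \<Rightarrow> real" where
  "Lp_dist M p F G = Lp_norm M p (\<lambda>x. (SOME f. f \<in> F) x - (SOME g. g \<in> G) x)"

definition Lp_closure :: "'a measure \<Rightarrow> real \<Rightarrow> ('a \<Rightarrow> real) set set \<Rightarrow> ('a \<Rightarrow> real) set set" where
  "Lp_closure M p S = Metric_space.mtopology (Lp M p) (Lp_dist M p) closure_of S"

definition nonsingular :: "'a measure \<Rightarrow> ('a \<Rightarrow> 'a) \<Rightarrow> bool" where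
  "nonsingular M \<phi> \<longleftrightarrow> \<phi> \<in> M \<rightarrow>\<^sub>M M \<and>
     (\<forall>F \<in> sets M. emeasure M F = 0 \<longrightarrow> emeasure M (\<phi> -` F \<inter> space M) = 0)"

definition comp_domain :: "'a measure \<Rightarrow> real \<Rightarrow> ('a \<Rightarrow> 'a) \<Rightarrow> ('a \<Rightarrow> real) set set" where
  "comp_domain M p \<phi> =
     {f \<in> Lp_fun M p. (\<integral>\<^sup>+ x. ennreal (\<bar>(f \<circ> \<phi>) x\<bar> powr p) \<partial>M) < \<infinity>} // ae_eq M"

text \<open>
  An unbounded operator is a partial map on \<open>L\<^sup>p\<close>.  The union over all representatives
  is the usual lifting of a congruent operation to equivalence classes, see \<open>comp_op_class\<close>.
\<close>

definition comp_op ::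
    "'a measure \<Rightarrow> real \<Rightarrow> ('a \<Rightarrow> 'a) \<Rightarrow> ('a \<Rightarrow> real) set \<rightharpoonup> ('a \<Rightarrow> real) set" where
  "comp_op M p \<phi> = (\<lambda>F. Some (\<Union>f\<in>F. ae_eq M `` {f \<circ> \<phi>})) |` comp_domain M p \<phi>"

definition densely_defined ::
    "'a measure \<Rightarrow> real \<Rightarrow> (('a \<Rightarrow> real) set \<rightharpoonup> ('a \<Rightarrow> real) set) \<Rightarrow> bool" where
  "densely_defined M p T \<longleftrightarrow> dom T \<subseteq> Lp M p \<and> Lp_closure M p (dom T) = Lp M p"

lemma equiv_ae_eq: "equiv (borel_measurable M) (ae_eq M)"
  unfolding equiv_def refl_on_def sym_def trans_def ae_eq_def by auto

lemma Lp_fun_ae: "(f, g) \<in> ae_eq M \<Longrightarrow> f \<in> Lp_fun M p \<Longrightarrow> g \<in> Lp_fun M p"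
proof -
  assume a: "(f, g) \<in> ae_eq M" "f \<in> Lp_fun M p"
  then have "(\<integral>\<^sup>+ x. ennreal (\<bar>f x\<bar> powr p) \<partial>M) = (\<integral>\<^sup>+ x. ennreal (\<bar>g x\<bar> powr p) \<partial>M)"
    by (intro nn_integral_cong_AE) (auto simp: ae_eq_def)
  with a show ?thesis by (auto simp: Lp_fun_def ae_eq_def)
qed

lemma Lp_fun_integrable: "f \<in> Lp_fun M p \<Longrightarrow> integrable M (\<lambda>x. \<bar>f x\<bar> powr p)"
  unfolding Lp_fun_def by (auto intro!: integrableI_bounded)

lemma Lp_class_in: "f \<in> Lp_fun M p \<Longrightarrow> ae_eq M `` {f} \<in> Lp M p"
  by (simp add: Lp_def quotientI)

lemma Lp_rep:
  assumes "F \<in> Lp M p"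
  shows "(SOME f. f \<in> F) \<in> F"
proof -
  obtain f where "f \<in> Lp_fun M p" "F = ae_eq M `` {f}"
    using assms by (auto simp: Lp_def elim: quotientE)
  then have "f \<in> F" by (auto simp: Lp_fun_def ae_eq_def)
  then show ?thesis by (rule someI[where P = "\<lambda>f. f \<in> F"])
qed

lemma Lp_eq_class:
  assumes "F \<in> Lp M p" "f \<in> F"
  shows "f \<in> Lp_fun M p" "F = ae_eq M `` {f}"
proof -
  obtain f0 where f0: "f0 \<in> Lp_fun M p" "F = ae_eq M `` {f0}"
    using assms by (auto simp: Lp_def elim: quotientE)
  with assms have r: "(f0, f) \<in> ae_eq M" by auto
  show "f \<in> Lp_fun M p" using Lp_fun_ae[OF r f0(1)] .
  show "F = ae_eq M `` {f}" using equiv_class_eq[OF equiv_ae_eq r] f0 by simp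
qed

lemma Lp_dist_eq:
  assumes "F \<in> Lp M p" "G \<in> Lp M p" "f \<in> F" "g \<in> G"
  shows "Lp_dist M p F G = Lp_norm M p (\<lambda>x. f x - g x)"
proof -
  have 1: "(f, SOME f. f \<in> F) \<in> ae_eq M"
    using Lp_rep[OF assms(1)] Lp_eq_class(2)[OF assms(1,3)] by blast
  have 2: "(g, SOME g. g \<in> G) \<in> ae_eq M"
    using Lp_rep[OF assms(2)] Lp_eq_class(2)[OF assms(2,4)] by blast
  have [measurable]: "f \<in> borel_measurable M" "g \<in> borel_measurable M"
      "(SOME f. f \<in> F) \<in> borel_measurable M" "(SOME g. g \<in> G) \<in> borel_measurable M"
    using 1 2 by (auto simp: ae_eq_def)
  have "(\<integral>x. \<bar>(SOME f. f \<in> F) x - (SOME g. g \<in> G) x\<bar> powr p \<partial>M) = (\<integral>x. \<bar>f x - g x\<bar> powr p \<partial>M)"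
    using 1 2 by (intro integral_cong_AE) (auto simp: ae_eq_def)
  then show ?thesis by (simp add: Lp_dist_def Lp_norm_def)
qed

lemma powr_convex_ineq:
  fixes p t u v :: real
  assumes p: "1 \<le> p" and t: "0 < t" "t < 1" and uv: "0 \<le> u" "0 \<le> v"
  shows "(t * u + (1 - t) * v) powr p \<le> t * u powr p + (1 - t) * v powr p"
proof -
  have s: "s powr p \<le> s" if "0 < s" "s < 1" for s :: real
    using powr_mono'[of 1 p s] p that by simp
  consider "u = 0" | "v = 0" | "0 < u" "0 < v" using uv by linarith
  then show ?thesis
  proof cases
    case 1
    have "((1 - t) * v) powr p = (1 - t) powr p * v powr p"
      using t uv by (simp add: powr_mult)
    also have "\<dots> \<le> (1 - t) * v powr p"
      using s[of "1 - t"] t by (intro mult_right_mono) auto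
    finally show ?thesis using 1 p by simp
  next
    case 2
    have "(t * u) powr p = t powr p * u powr p"
      using t uv by (simp add: powr_mult)
    also have "\<dots> \<le> t * u powr p"
      using s[of t] t by (intro mult_right_mono) auto
    finally show ?thesis using 2 p by simp
  next
    case 3
    then show ?thesis
      using convex_onD[OF powr_convex[OF p], of "1 - t" u v] t by simp
  qed
qed

lemma Lp_norm_nonneg: "0 \<le> Lp_norm M p f"
  by (simp add: Lp_norm_def)

lemma Lp_norm_powr:
  assumes "1 \<le> p" shows "Lp_norm M p f powr p = (\<integral>x. \<bar>f x\<bar> powr p \<partial>M)"
  using assms by (simp add: Lp_norm_def powr_powr)

lemma Lp_minkowski:
  assumes p: "1 \<le> p" and f: "f \<in> Lp_fun M p" and g: "g \<in> Lp_fun M p"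
  shows "(\<lambda>x. f x + g x) \<in> Lp_fun M p"
    and "Lp_norm M p (\<lambda>x. f x + g x) \<le> Lp_norm M p f + Lp_norm M p g"
proof -
  have [measurable]: "f \<in> borel_measurable M" "g \<in> borel_measurable M"
    using f g by (auto simp: Lp_fun_def)
  note [simp] = Lp_fun_integrable[OF f] Lp_fun_integrable[OF g]
  have pt: "\<bar>f x + g x\<bar> powr p \<le>
      (A + B) powr p * (A / (A + B) * (\<bar>f x\<bar> powr p / A powr p) + B / (A + B) * (\<bar>g x\<bar> powr p / B powr p))"
    if AB: "0 < A" "0 < B" for A B x
  proof -
    let ?t = "A / (A + B)"
    have t: "1 - ?t = B / (A + B)" using AB by (simp add: field_simps)
    have "\<bar>f x + g x\<bar> powr p \<le> ((A + B) * (?t * (\<bar>f x\<bar> / A) + (1 - ?t) * (\<bar>g x\<bar> / B))) powr p"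
    proof (rule powr_mono2)
      have "(A + B) * (?t * (\<bar>f x\<bar> / A) + (1 - ?t) * (\<bar>g x\<bar> / B)) = \<bar>f x\<bar> + \<bar>g x\<bar>"
        unfolding t distrib_left using AB by simp
      then show "\<bar>f x + g x\<bar> \<le> (A + B) * (?t * (\<bar>f x\<bar> / A) + (1 - ?t) * (\<bar>g x\<bar> / B))" by linarith
    qed (use p in auto)
    also have "\<dots> = (A + B) powr p * (?t * (\<bar>f x\<bar> / A) + (1 - ?t) * (\<bar>g x\<bar> / B)) powr p"
      unfolding t using AB by (subst powr_mult) auto
    also have "\<dots> \<le> (A + B) powr p * (?t * (\<bar>f x\<bar> / A) powr p + (1 - ?t) * (\<bar>g x\<bar> / B) powr p)"
      using AB by (intro mult_left_mono powr_convex_ineq p) auto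
    also have "\<dots> = (A + B) powr p * (A / (A + B) * (\<bar>f x\<bar> powr p / A powr p) + B / (A + B) * (\<bar>g x\<bar> powr p / B powr p))"
      unfolding t using AB by (simp add: powr_divide)
    finally show ?thesis .
  qed
  have int: "integrable M (\<lambda>x. \<bar>f x + g x\<bar> powr p)"
  proof (rule Bochner_Integration.integrable_bound)
    show "integrable M (\<lambda>x. 2 powr p * (\<bar>f x\<bar> powr p / 2 + \<bar>g x\<bar> powr p / 2))"
      by (intro integrable_mult_right Bochner_Integration.integrable_add integrable_divide_zero) simp_all
    have "\<bar>f x + g x\<bar> powr p \<le> 2 powr p * (\<bar>f x\<bar> powr p / 2 + \<bar>g x\<bar> powr p / 2)" for x
      using pt[of 1 1 x] by simp
    then show "AE x in M. norm (\<bar>f x + g x\<bar> powr p) \<le> norm (2 powr p * (\<bar>f x\<bar> powr p / 2 + \<bar>g x\<bar> powr p / 2))"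
      by (intro AE_I2) (simp add: order_trans[OF _ abs_ge_self])
  qed simp
  then have "(\<integral>\<^sup>+ x. ennreal (norm (\<bar>f x + g x\<bar> powr p)) \<partial>M) < \<infinity>"
    by (simp only: integrable_iff_bounded)
  then show "(\<lambda>x. f x + g x) \<in> Lp_fun M p" by (simp add: Lp_fun_def)
  let ?a = "Lp_norm M p f" and ?b = "Lp_norm M p g"
  show "Lp_norm M p (\<lambda>x. f x + g x) \<le> ?a + ?b"
  proof (rule field_le_epsilon)
    fix e :: real assume e: "0 < e"
    define A B where "A = ?a + e / 2" and "B = ?b + e / 2"
    have AB: "0 < A" "0 < B" "?a \<le> A" "?b \<le> B"
      using e Lp_norm_nonneg[of M p f] Lp_norm_nonneg[of M p g] by (auto simp: A_def B_def)
    have fA: "(\<integral>x. \<bar>f x\<bar> powr p \<partial>M) \<le> A powr p"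
      using p AB Lp_norm_nonneg[of M p f] by (subst Lp_norm_powr[OF p, symmetric]) (intro powr_mono2, auto)
    have gB: "(\<integral>x. \<bar>g x\<bar> powr p \<partial>M) \<le> B powr p"
      using p AB Lp_norm_nonneg[of M p g] by (subst Lp_norm_powr[OF p, symmetric]) (intro powr_mono2, auto)
    have "(\<integral>x. \<bar>f x + g x\<bar> powr p \<partial>M) \<le> (\<integral>x. (A + B) powr p * (A / (A + B) * (\<bar>f x\<bar> powr p / A powr p)
        + B / (A + B) * (\<bar>g x\<bar> powr p / B powr p)) \<partial>M)"
      by (intro integral_mono int pt AB integrable_mult_right Bochner_Integration.integrable_add integrable_divide_zero) simp_all
    also have "\<dots> = (A + B) powr p * (A / (A + B) * ((\<integral>x. \<bar>f x\<bar> powr p \<partial>M) / A powr p)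
        + B / (A + B) * ((\<integral>x. \<bar>g x\<bar> powr p \<partial>M) / B powr p))"
      by (simp add: Bochner_Integration.integral_add)
    also have "\<dots> \<le> (A + B) powr p * (A / (A + B) * 1 + B / (A + B) * 1)"
      using AB fA gB by (intro mult_left_mono add_mono) auto
    also have "\<dots> = (A + B) powr p"
      using AB by (simp add: add_divide_distrib[symmetric])
    finally have "Lp_norm M p (\<lambda>x. f x + g x) \<le> ((A + B) powr p) powr (1 / p)"
      unfolding Lp_norm_def using p by (intro powr_mono2) auto
    also have "\<dots> = A + B" using p AB by (simp add: powr_powr)
    finally show "Lp_norm M p (\<lambda>x. f x + g x) \<le> ?a + ?b + e" by (simp add: A_def B_def)
  qed
qed

lemma Lp_norm_minus: "Lp_norm M p (\<lambda>x. f x - g x) = Lp_norm M p (\<lambda>x. g x - f x)"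
  by (simp add: Lp_norm_def abs_minus_commute)

lemma Lp_fun_diff:
  assumes "1 \<le> p" "f \<in> Lp_fun M p" "g \<in> Lp_fun M p"
  shows "(\<lambda>x. f x - g x) \<in> Lp_fun M p"
proof -
  have "(\<lambda>x. - g x) \<in> Lp_fun M p" using assms(3) by (simp add: Lp_fun_def)
  from Lp_minkowski(1)[OF assms(1,2) this] show ?thesis by simp
qed

theorem Metric_space_Lp:
  assumes p: "1 \<le> p"
  shows "Metric_space (Lp M p) (Lp_dist M p)"
proof
  fix F G show "0 \<le> Lp_dist M p F G" by (simp add: Lp_dist_def Lp_norm_nonneg)
  show "Lp_dist M p F G = Lp_dist M p G F" unfolding Lp_dist_def by (rule Lp_norm_minus)
next
  fix F G assume FG: "F \<in> Lp M p" "G \<in> Lp M p"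
  obtain f g where fg: "f \<in> F" "g \<in> G" using Lp_rep FG by blast
  note f = Lp_eq_class[OF FG(1) fg(1)] and g = Lp_eq_class[OF FG(2) fg(2)]
  have [measurable]: "f \<in> borel_measurable M" "g \<in> borel_measurable M"
    using f g by (auto simp: Lp_fun_def)
  have "Lp_dist M p F G = 0 \<longleftrightarrow> (\<integral>x. \<bar>f x - g x\<bar> powr p \<partial>M) = 0"
    using p by (simp add: Lp_dist_eq[OF FG fg] Lp_norm_def)
  also have "\<dots> \<longleftrightarrow> (AE x in M. \<bar>f x - g x\<bar> powr p = 0)"
    using Lp_fun_integrable[OF Lp_fun_diff[OF p f(1) g(1)]]
    by (intro integral_nonneg_eq_0_iff_AE) auto
  also have "\<dots> \<longleftrightarrow> (f, g) \<in> ae_eq M" using p by (simp add: ae_eq_def)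
  also have "\<dots> \<longleftrightarrow> F = G"
    unfolding f(2) g(2) by (subst eq_equiv_class_iff[OF equiv_ae_eq]) auto
  finally show "Lp_dist M p F G = 0 \<longleftrightarrow> F = G" .
next
  fix F G H assume FGH: "F \<in> Lp M p" "G \<in> Lp M p" "H \<in> Lp M p"
  obtain f g h where fgh: "f \<in> F" "g \<in> G" "h \<in> H" using Lp_rep FGH by meson
  have "Lp_norm M p (\<lambda>x. (f x - g x) + (g x - h x)) \<le>
      Lp_norm M p (\<lambda>x. f x - g x) + Lp_norm M p (\<lambda>x. g x - h x)"
    using Lp_eq_class(1) FGH fgh by (intro Lp_minkowski(2) Lp_fun_diff p) blast+
  then show "Lp_dist M p F H \<le> Lp_dist M p F G + Lp_dist M p G H"
    using FGH fgh by (simp add: Lp_dist_eq)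
qed

lemma nonsingular_AE:
  assumes "nonsingular M \<phi>" "AE x in M. P x"
  shows "AE x in M. P (\<phi> x)"
proof -
  have m: "\<phi> \<in> M \<rightarrow>\<^sub>M M" using assms(1) by (simp add: nonsingular_def)
  obtain N where N: "{x \<in> space M. \<not> P x} \<subseteq> N" "emeasure M N = 0" "N \<in> sets M"
    using assms(2) by (rule AE_E)
  show ?thesis
  proof (rule AE_I)
    show "{x \<in> space M. \<not> P (\<phi> x)} \<subseteq> \<phi> -` N \<inter> space M"
      using N(1) measurable_space[OF m] by auto
    show "emeasure M (\<phi> -` N \<inter> space M) = 0" using assms(1) N by (auto simp: nonsingular_def)
    show "\<phi> -` N \<inter> space M \<in> sets M" using m N(3) by (rule measurable_sets)
  qed
qed

lemma ae_eq_comp: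
  assumes "nonsingular M \<phi>" "(f, g) \<in> ae_eq M"
  shows "(f \<circ> \<phi>, g \<circ> \<phi>) \<in> ae_eq M"
proof -
  have "\<phi> \<in> M \<rightarrow>\<^sub>M M" using assms(1) by (simp add: nonsingular_def)
  moreover have "AE x in M. f (\<phi> x) = g (\<phi> x)"
    using assms(2) by (intro nonsingular_AE[OF assms(1)]) (simp add: ae_eq_def)
  ultimately show ?thesis using assms(2) by (auto simp: ae_eq_def intro: measurable_comp)
qed

lemma dom_comp_op: "dom (comp_op M p \<phi>) = comp_domain M p \<phi>"
  by (auto simp: comp_op_def)

lemma comp_domain_subset: "comp_domain M p \<phi> \<subseteq> Lp M p"
  by (auto simp: comp_domain_def Lp_def quotient_def)

lemma comp_domain_class:
  assumes ns: "nonsingular M \<phi>" and f: "f \<in> Lp_fun M p"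
  shows "ae_eq M `` {f} \<in> comp_domain M p \<phi> \<longleftrightarrow> f \<circ> \<phi> \<in> Lp_fun M p"
proof -
  have m: "\<phi> \<in> M \<rightarrow>\<^sub>M M" using ns by (simp add: nonsingular_def)
  have meas: "g \<circ> \<phi> \<in> borel_measurable M" if "g \<in> Lp_fun M p" for g
    using m that by (auto simp: Lp_fun_def intro: measurable_comp)
  have "f \<circ> \<phi> \<in> Lp_fun M p"
    if "g \<in> Lp_fun M p" "g \<circ> \<phi> \<in> Lp_fun M p" "ae_eq M `` {f} = ae_eq M `` {g}" for g
  proof (rule Lp_fun_ae[OF ae_eq_comp[OF ns] that(2)])
    show "(g, f) \<in> ae_eq M"
      using that(3) f by (auto simp: Lp_fun_def ae_eq_def)
  qed
  then show ?thesis
    using f meas unfolding comp_domain_def quotient_def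
    by (fastforce simp: Lp_fun_def)
qed

lemma comp_op_class:
  assumes ns: "nonsingular M \<phi>" and f: "f \<in> Lp_fun M p" "f \<circ> \<phi> \<in> Lp_fun M p"
  shows "comp_op M p \<phi> (ae_eq M `` {f}) = Some (ae_eq M `` {f \<circ> \<phi>})"
proof -
  have ff: "(f, f) \<in> ae_eq M" using f by (simp add: ae_eq_def Lp_fun_def)
  have "ae_eq M `` {g \<circ> \<phi>} = ae_eq M `` {f \<circ> \<phi>}" if "g \<in> ae_eq M `` {f}" for g
    using equiv_class_eq[OF equiv_ae_eq ae_eq_comp[OF ns]] that by blast
  then have "(\<Union>g\<in>ae_eq M `` {f}. ae_eq M `` {g \<circ> \<phi>}) = ae_eq M `` {f \<circ> \<phi>}"
    using ff by blast
  then show ?thesis using comp_domain_class[OF ns f(1)] f(2) by (simp add: comp_op_def)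
qed

text \<open>
  \<open>distr M M \<phi>\<close> is the image measure \<open>A \<mapsto> \<mu>(\<phi>\<^sup>-\<^sup>1 A)\<close>, which need not be \<open>\<sigma>\<close>-finite,
  so the derivative may take the value \<open>\<infinity>\<close>.
\<close>

lemma RN_deriv_nonsingular:
  assumes "sigma_finite_measure M" and ns: "nonsingular M \<phi>" and h: "h \<in> borel_measurable M"
  shows "(AE x in M. h x = RN_deriv M (distr M M \<phi>) x) \<longleftrightarrow>
    (\<forall>A\<in>sets M. emeasure M (\<phi> -` A \<inter> space M) = (\<integral>\<^sup>+ x\<in>A. h x \<partial>M))"
proof -
  interpret sigma_finite_measure M by fact
  have m: "\<phi> \<in> M \<rightarrow>\<^sub>M M" using ns by (simp add: nonsingular_def)
  have ac: "absolutely_continuous M (distr M M \<phi>)"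
    using ns m by (auto simp: absolutely_continuous_def nonsingular_def null_sets_def emeasure_distr)
  have "(AE x in M. h x = RN_deriv M (distr M M \<phi>) x) \<longleftrightarrow>
      density M h = density M (RN_deriv M (distr M M \<phi>))"
    using h by (intro density_unique_iff[symmetric]) auto
  also have "\<dots> \<longleftrightarrow> density M h = distr M M \<phi>"
    by (simp add: density_RN_deriv[OF ac])
  also have "\<dots> \<longleftrightarrow> (\<forall>A\<in>sets M. emeasure M (\<phi> -` A \<inter> space M) = (\<integral>\<^sup>+ x\<in>A. h x \<partial>M))"
  proof
    assume eq: "density M h = distr M M \<phi>"
    show "\<forall>A\<in>sets M. emeasure M (\<phi> -` A \<inter> space M) = (\<integral>\<^sup>+ x\<in>A. h x \<partial>M)"
      using h m by (auto simp flip: emeasure_density simp: emeasure_distr eq)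
  next
    assume "\<forall>A\<in>sets M. emeasure M (\<phi> -` A \<inter> space M) = (\<integral>\<^sup>+ x\<in>A. h x \<partial>M)"
    then show "density M h = distr M M \<phi>"
      using h m by (intro measure_eqI) (auto simp: emeasure_density emeasure_distr)
  qed
  finally show ?thesis .
qed

lemma Lp_density_subset:
  assumes h[measurable]: "h \<in> borel_measurable M"
  shows "Lp (density M (\<lambda>x. 1 + h x)) p \<subseteq> Lp M p"
proof -
  let ?N = "density M (\<lambda>x. 1 + h x)"
  have "ae_eq ?N = ae_eq M"
    by (auto simp: ae_eq_def AE_density add_pos_nonneg)
  moreover have "Lp_fun ?N p \<subseteq> Lp_fun M p"
  proof
    fix f assume f: "f \<in> Lp_fun ?N p"
    then have [measurable]: "f \<in> borel_measurable M" by (simp add: Lp_fun_def)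
    have "(\<integral>\<^sup>+ x. ennreal (\<bar>f x\<bar> powr p) \<partial>M) \<le> (\<integral>\<^sup>+ x. (1 + h x) * ennreal (\<bar>f x\<bar> powr p) \<partial>M)"
      by (intro nn_integral_mono) (simp add: distrib_right)
    also have "\<dots> = (\<integral>\<^sup>+ x. ennreal (\<bar>f x\<bar> powr p) \<partial>?N)"
      by (simp add: nn_integral_density)
    also have "\<dots> < \<infinity>" using f by (simp add: Lp_fun_def)
    finally show "f \<in> Lp_fun M p" by (simp add: Lp_fun_def)
  qed
  ultimately show ?thesis by (auto simp: Lp_def quotient_def)
qed

end

theory Submission
  imports Defs
begin

text \<open>
  Change of variables gives \<open>\<integral> \<bar>f \<circ> \<phi>\<bar>\<^sup>p d\<mu> = \<integral> h \<bar>f\<bar>\<^sup>p d\<mu>\<close>, so the domain of the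
  composition operator is exactly \<open>L\<^sup>p(\<nu>)\<close>. If \<open>h < \<infinity>\<close> a.e., the truncations \<open>f \<cdot> 1{h \<le> n}\<close> lie in
  this domain and converge to \<open>f\<close> by dominated convergence. Conversely, every element of the
  domain vanishes a.e. on \<open>{h = \<infinity>}\<close>, and this property passes to the closure, whereas by
  \<open>\<sigma>\<close>-finiteness \<open>L\<^sup>p(\<mu>)\<close> contains a function that is positive everywhere.
\<close>

text \<open>Reduces closure in the metric space of classes to an \<epsilon>-condition on functions:
  \<open>Lp_dist\<close> may be computed from any representatives, so points of a ball around the
  class of \<open>f\<close> correspond to functions \<open>g\<close> near \<open>f\<close>.\<close>

lemma Lp_closure_iff:
  assumes p: "1 \<le> p" and S: "S \<subseteq> Lp M p" and f: "f \<in> Lp_fun M p"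
  shows "ae_eq M `` {f} \<in> Lp_closure M p S \<longleftrightarrow>
    (\<forall>e>0. \<exists>g\<in>Lp_fun M p. ae_eq M `` {g} \<in> S \<and> Lp_norm M p (\<lambda>x. f x - g x) < e)"
proof -
  interpret Metric_space "Lp M p" "Lp_dist M p" by (rule Metric_space_Lp[OF p])
  have self: "g \<in> ae_eq M `` {g}" if "g \<in> Lp_fun M p" for g
    using that by (simp add: ae_eq_def Lp_fun_def)
  have dist: "Lp_dist M p (ae_eq M `` {f}) (ae_eq M `` {g}) = Lp_norm M p (\<lambda>x. f x - g x)"
    if "g \<in> Lp_fun M p" for g
    using f that by (intro Lp_dist_eq Lp_class_in self)
  have "(\<exists>G\<in>S. G \<in> mball (ae_eq M `` {f}) e) \<longleftrightarrow>
      (\<exists>g\<in>Lp_fun M p. ae_eq M `` {g} \<in> S \<and> Lp_norm M p (\<lambda>x. f x - g x) < e)" for e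
  proof
    assume "\<exists>G\<in>S. G \<in> mball (ae_eq M `` {f}) e"
    then obtain G where G: "G \<in> S" "G \<in> Lp M p" "Lp_dist M p (ae_eq M `` {f}) G < e"
      by auto
    then obtain g where g: "g \<in> G" using Lp_rep by blast
    note Lp_eq_class[OF G(2) g]
    then show "\<exists>g\<in>Lp_fun M p. ae_eq M `` {g} \<in> S \<and> Lp_norm M p (\<lambda>x. f x - g x) < e"
      using G dist by (intro bexI[of _ g]) auto
  next
    assume "\<exists>g\<in>Lp_fun M p. ae_eq M `` {g} \<in> S \<and> Lp_norm M p (\<lambda>x. f x - g x) < e"
    then obtain g where g: "g \<in> Lp_fun M p" "ae_eq M `` {g} \<in> S" "Lp_norm M p (\<lambda>x. f x - g x) < e"
      by blast
    then show "\<exists>G\<in>S. G \<in> mball (ae_eq M `` {f}) e"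
      using dist[OF g(1)] Lp_class_in[OF f] Lp_class_in[OF g(1)]
      by (intro bexI[of _ "ae_eq M `` {g}"]) auto
  qed
  then show ?thesis
    using Lp_class_in[OF f] by (simp add: Lp_closure_def metric_closure_of)
qed

lemma Lp_closure_subset:
  assumes "1 \<le> p"
  shows "Lp_closure M p S \<subseteq> Lp M p"
proof -
  interpret Metric_space "Lp M p" "Lp_dist M p" by (rule Metric_space_Lp[OF assms])
  show ?thesis by (auto simp: Lp_closure_def metric_closure_of)
qed

text \<open>For \<open>g\<close> from \<open>S\<close>, the functions \<open>f\<close> and
  \<open>f - g\<close> agree a.e. on \<open>A\<close>. Hence the norm of \<open>f\<close> restricted
  to \<open>A\<close> is at most the distance from \<open>f\<close> to \<open>g\<close>, which can
  be made arbitrarily small.\<close>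

lemma Lp_closure_vanishing:
  assumes p: "1 \<le> p" and S: "S \<subseteq> Lp M p" and f: "f \<in> Lp_fun M p"
    and cl: "ae_eq M `` {f} \<in> Lp_closure M p S" and A[measurable]: "A \<in> sets M"
    and van: "\<And>g. g \<in> Lp_fun M p \<Longrightarrow> ae_eq M `` {g} \<in> S \<Longrightarrow> AE x in M. x \<in> A \<longrightarrow> g x = 0"
  shows "AE x in M. x \<in> A \<longrightarrow> f x = 0"
proof -
  have [measurable]: "f \<in> borel_measurable M" using f by (simp add: Lp_fun_def)
  let ?u = "\<lambda>x. indicator A x * f x"
  \<comment> \<open>The indicator only takes the values 0 and 1, and \<open>0 powr p = 0\<close>, so
    it can be pulled out of the power.\<close>
  have pu: "\<bar>?u x\<bar> powr p = indicator A x * \<bar>f x\<bar> powr p" for x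
    by (simp add: indicator_def)
  have int: "integrable M (\<lambda>x. \<bar>?u x\<bar> powr p)"
    unfolding pu by (rule integrable_real_mult_indicator[OF A Lp_fun_integrable[OF f], simplified mult.commute])
  have "Lp_norm M p ?u < e" if e: "0 < e" for e
  proof -
    obtain g where g: "g \<in> Lp_fun M p" "ae_eq M `` {g} \<in> S" "Lp_norm M p (\<lambda>x. f x - g x) < e"
      using Lp_closure_iff[OF p S f] cl e by blast
    have "(\<integral>x. \<bar>?u x\<bar> powr p \<partial>M) \<le> (\<integral>x. \<bar>f x - g x\<bar> powr p \<partial>M)"
      using van[OF g(1,2)] int Lp_fun_integrable[OF Lp_fun_diff[OF p f g(1)]]
      by (intro integral_mono_AE) (auto simp: indicator_def elim!: eventually_mono)
    then have "Lp_norm M p ?u \<le> Lp_norm M p (\<lambda>x. f x - g x)"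
      unfolding Lp_norm_def using p by (intro powr_mono2) auto
    with g show ?thesis by simp
  qed
  \<comment> \<open>If the norm were positive, it could itself serve as \<open>e\<close> and would
    be smaller than itself.\<close>
  from this[of "Lp_norm M p ?u"] have "Lp_norm M p ?u = 0"
    using Lp_norm_nonneg[of M p ?u] by force
  then have "(\<integral>x. \<bar>?u x\<bar> powr p \<partial>M) = 0"
    using p by (simp add: Lp_norm_def)
  then have "AE x in M. \<bar>?u x\<bar> powr p = 0"
    using int by (subst (asm) integral_nonneg_eq_0_iff_AE) auto
  then show ?thesis using p by (auto elim!: eventually_mono)
qed

text \<open>The p-th root of a strictly positive integrable function, which exists by
  \<sigma>-finiteness. It serves as a test function that vanishes nowhere.\<close>

lemma positive_Lp_fun:
  assumes "sigma_finite_measure M" and p: "1 \<le> p"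
  obtains w where "w \<in> Lp_fun M p" "\<And>x. 0 < w x"
proof -
  interpret sigma_finite_measure M by fact
  obtain u :: "'a \<Rightarrow> real" where u: "u \<in> borel_measurable M" "\<And>x. u x > 0" "integrable M u"
    using obtain_positive_integrable_function by metis
  have [measurable]: "u \<in> borel_measurable M" by fact
  have "\<bar>u x powr (1 / p)\<bar> powr p = norm (u x)" for x
    using p u(2)[of x] by (simp add: powr_powr)
  moreover have "(\<integral>\<^sup>+ x. ennreal (norm (u x)) \<partial>M) < \<infinity>"
    using u(3) by (simp only: integrable_iff_bounded)
  ultimately have "(\<lambda>x. u x powr (1 / p)) \<in> Lp_fun M p"
    unfolding Lp_fun_def by (simp only: mem_Collect_eq) simp
  moreover have "0 < u x powr (1 / p)" for x using u(2)[of x] by simp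
  ultimately show ?thesis using that by blast
qed

text \<open>Change of variables: the left side integrates \<open>g\<close> against the image measure
  \<open>distr M M \<phi>\<close>, whose density with respect to \<open>M\<close> is
  \<open>h\<close>.\<close>

lemma nn_integral_comp_nonsingular:
  assumes "sigma_finite_measure M" and ns: "nonsingular M \<phi>"
    and h[measurable]: "h \<in> borel_measurable M"
    and RN: "AE x in M. h x = RN_deriv M (distr M M \<phi>) x"
    and g[measurable]: "g \<in> borel_measurable M"
  shows "(\<integral>\<^sup>+ x. g (\<phi> x) \<partial>M) = (\<integral>\<^sup>+ x. h x * g x \<partial>M)"
proof -
  have [measurable]: "\<phi> \<in> M \<rightarrow>\<^sub>M M" using ns by (simp add: nonsingular_def)
  have "distr M M \<phi> = density M h"
    using RN_deriv_nonsingular[OF assms(1) ns h] RN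
    by (intro measure_eqI) (auto simp: emeasure_density emeasure_distr)
  then have "(\<integral>\<^sup>+ x. g x \<partial>distr M M \<phi>) = (\<integral>\<^sup>+ x. g x \<partial>density M h)" by simp
  then show ?thesis by (simp add: nn_integral_distr nn_integral_density)
qed

lemma comp_domain_iff:
  assumes "sigma_finite_measure M" and ns: "nonsingular M \<phi>"
    and h: "h \<in> borel_measurable M"
    and RN: "AE x in M. h x = RN_deriv M (distr M M \<phi>) x"
    and f: "f \<in> Lp_fun M p"
  shows "ae_eq M `` {f} \<in> comp_domain M p \<phi> \<longleftrightarrow>
    (\<integral>\<^sup>+ x. h x * ennreal (\<bar>f x\<bar> powr p) \<partial>M) < \<infinity>"
proof -
  have [measurable]: "f \<in> borel_measurable M" "\<phi> \<in> M \<rightarrow>\<^sub>M M"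
    using f ns by (auto simp: Lp_fun_def nonsingular_def)
  show ?thesis
    using nn_integral_comp_nonsingular[OF assms(1-4), of "\<lambda>x. ennreal (\<bar>f x\<bar> powr p)"]
    by (simp add: comp_domain_class[OF ns f]) (simp add: Lp_fun_def)
qed

text \<open>Integrating against \<open>1 + h\<close> adds the integral of the p-th power of
  \<open>f\<close> to that of its composition with \<open>\<phi>\<close>. The sum is finite iff both
  terms are, which is the condition defining the domain.\<close>

lemma Lp_density_eq_comp_domain:
  assumes "sigma_finite_measure M" and ns: "nonsingular M \<phi>"
    and h[measurable]: "h \<in> borel_measurable M"
    and RN: "AE x in M. h x = RN_deriv M (distr M M \<phi>) x"
  shows "Lp (density M (\<lambda>x. 1 + h x)) p = comp_domain M p \<phi>"
proof -
  let ?N = "density M (\<lambda>x. 1 + h x)"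
  have [measurable]: "\<phi> \<in> M \<rightarrow>\<^sub>M M" using ns by (simp add: nonsingular_def)
  \<comment> \<open>The density \<open>1 + h\<close> is positive everywhere, so both measures have
    the same null sets and hence the same classes.\<close>
  have "ae_eq ?N = ae_eq M"
    by (auto simp: ae_eq_def AE_density add_pos_nonneg)
  moreover have "Lp_fun ?N p =
      {f \<in> Lp_fun M p. (\<integral>\<^sup>+ x. ennreal (\<bar>(f \<circ> \<phi>) x\<bar> powr p) \<partial>M) < \<infinity>}"
  proof -
    have "(\<integral>\<^sup>+ x. ennreal (\<bar>f x\<bar> powr p) \<partial>?N) =
        (\<integral>\<^sup>+ x. ennreal (\<bar>f x\<bar> powr p) \<partial>M) + (\<integral>\<^sup>+ x. ennreal (\<bar>f (\<phi> x)\<bar> powr p) \<partial>M)"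
      if [measurable]: "f \<in> borel_measurable M" for f
      using nn_integral_comp_nonsingular[OF assms, of "\<lambda>x. ennreal (\<bar>f x\<bar> powr p)"]
      by (simp add: nn_integral_density distrib_right nn_integral_add)
    then show ?thesis by (auto simp: Lp_fun_def)
  qed
  ultimately show ?thesis by (simp add: Lp_def comp_domain_def)
qed

lemma comp_domain_dense:
  assumes "sigma_finite_measure M" and ns: "nonsingular M \<phi>"
    and h[measurable]: "h \<in> borel_measurable M"
    and RN: "AE x in M. h x = RN_deriv M (distr M M \<phi>) x"
    and p: "1 \<le> p" and fin: "AE x in M. h x < \<infinity>"
  shows "Lp_closure M p (comp_domain M p \<phi>) = Lp M p"
proof (rule antisym[OF Lp_closure_subset[OF p]], rule subsetI)
  fix F assume F: "F \<in> Lp M p"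
  then obtain f where f: "f \<in> Lp_fun M p" and Ff: "F = ae_eq M `` {f}"
    using Lp_rep Lp_eq_class by metis
  have [measurable]: "f \<in> borel_measurable M" using f by (simp add: Lp_fun_def)
  \<comment> \<open>Cutting off where \<open>h\<close> exceeds \<open>n\<close> bounds the weighted
    integrand by \<open>n\<close> times the p-th power of \<open>f\<close>, so each
    \<open>g n\<close> lies in the domain.\<close>
  define g where "g n x = (if h x \<le> of_nat n then f x else 0)" for n :: nat and x
  have [measurable]: "g n \<in> borel_measurable M" for n unfolding g_def by measurable
  have "(\<integral>\<^sup>+ x. ennreal (\<bar>g n x\<bar> powr p) \<partial>M) \<le> (\<integral>\<^sup>+ x. ennreal (\<bar>f x\<bar> powr p) \<partial>M)" for n
    by (intro nn_integral_mono) (auto simp: g_def)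
  then have g: "g n \<in> Lp_fun M p" for n
    using f by (auto simp: Lp_fun_def intro: le_less_trans)
  have gdom: "ae_eq M `` {g n} \<in> comp_domain M p \<phi>" for n
  proof -
    have "(\<integral>\<^sup>+ x. h x * ennreal (\<bar>g n x\<bar> powr p) \<partial>M) \<le>
        (\<integral>\<^sup>+ x. of_nat n * ennreal (\<bar>f x\<bar> powr p) \<partial>M)"
      by (intro nn_integral_mono) (auto simp: g_def intro: mult_right_mono)
    also have "\<dots> = of_nat n * (\<integral>\<^sup>+ x. ennreal (\<bar>f x\<bar> powr p) \<partial>M)"
      by (simp add: nn_integral_cmult)
    also have "\<dots> < \<infinity>"
      using f by (simp add: Lp_fun_def ennreal_mult_less_top of_nat_less_top)
    finally show ?thesis by (simp add: comp_domain_iff[OF assms(1-4) g])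
  qed
  have "(\<lambda>n. \<integral>x. \<bar>f x - g n x\<bar> powr p \<partial>M) \<longlonglongrightarrow> (\<integral>x. 0 \<partial>M)"
  proof (rule integral_dominated_convergence)
    show "integrable M (\<lambda>x. \<bar>f x\<bar> powr p)" by (rule Lp_fun_integrable[OF f])
    \<comment> \<open>Wherever \<open>h x\<close> is finite, the sequence is eventually constant 0,
      namely once \<open>n\<close> exceeds \<open>h x\<close>.\<close>
    show "AE x in M. (\<lambda>n. \<bar>f x - g n x\<bar> powr p) \<longlonglongrightarrow> 0"
      using fin
    proof eventually_elim
      case (elim x)
      then obtain N :: nat where "h x \<le> of_nat N"
        using ennreal_Ex_less_of_nat[of "h x"] by (auto intro: less_imp_le)
      then have "g n x = f x" if "N \<le> n" for n
        using that by (auto simp: g_def intro: order_trans)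
      then show ?case
        by (intro tendsto_eventually eventually_sequentiallyI[of N]) simp
    qed
    show "AE x in M. norm (\<bar>f x - g n x\<bar> powr p) \<le> \<bar>f x\<bar> powr p" for n
      by (simp add: g_def)
  qed auto
  \<comment> \<open>The base tends to 0, where continuity of \<open>powr\<close> relies on
    nonnegative bases and the positive exponent \<open>1 / p\<close>.\<close>
  then have "(\<lambda>n. Lp_norm M p (\<lambda>x. f x - g n x)) \<longlonglongrightarrow> 0 powr (1 / p)"
    unfolding Lp_norm_def using p by (intro tendsto_powr') auto
  then have lim: "(\<lambda>n. Lp_norm M p (\<lambda>x. f x - g n x)) \<longlonglongrightarrow> 0" by simp
  show "F \<in> Lp_closure M p (comp_domain M p \<phi>)"
    unfolding Ff Lp_closure_iff[OF p comp_domain_subset f]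
  proof (intro allI impI)
    fix e :: real assume "0 < e"
    from order_tendstoD(2)[OF lim this]
    obtain n where "Lp_norm M p (\<lambda>x. f x - g n x) < e"
      by (auto simp: eventually_sequentially)
    with g gdom show "\<exists>g\<in>Lp_fun M p. ae_eq M `` {g} \<in> comp_domain M p \<phi> \<and>
        Lp_norm M p (\<lambda>x. f x - g x) < e" by blast
  qed
qed

lemma comp_domain_dense_imp_finite:
  assumes sf: "sigma_finite_measure M" and ns: "nonsingular M \<phi>"
    and h[measurable]: "h \<in> borel_measurable M"
    and RN: "AE x in M. h x = RN_deriv M (distr M M \<phi>) x"
    and p: "1 \<le> p" and dense: "Lp_closure M p (comp_domain M p \<phi>) = Lp M p"
  shows "AE x in M. h x < \<infinity>"
proof -
  obtain w where w: "w \<in> Lp_fun M p" and pos: "\<And>x. 0 < w x"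
    using positive_Lp_fun[OF sf p] by metis
  let ?A = "{x \<in> space M. h x = \<infinity>}"
  have "AE x in M. x \<in> ?A \<longrightarrow> w x = 0"
  proof (rule Lp_closure_vanishing[OF p comp_domain_subset w])
    show "ae_eq M `` {w} \<in> Lp_closure M p (comp_domain M p \<phi>)"
      using Lp_class_in[OF w] dense by simp
    show "?A \<in> sets M" by measurable
    fix g assume g: "g \<in> Lp_fun M p" "ae_eq M `` {g} \<in> comp_domain M p \<phi>"
    then have [measurable]: "g \<in> borel_measurable M" by (simp add: Lp_fun_def)
    \<comment> \<open>A function with finite integral is finite a.e. Where
      \<open>h x = \<infinity>\<close>, the product is finite only if
      \<open>g x = 0\<close>.\<close>
    have "AE x in M. h x * ennreal (\<bar>g x\<bar> powr p) \<noteq> \<infinity>"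
      using g(2) comp_domain_iff[OF assms(1-4) g(1)]
      by (intro nn_integral_noteq_infinite) auto
    then show "AE x in M. x \<in> ?A \<longrightarrow> g x = 0"
      using p by (auto simp: ennreal_mult_eq_top_iff elim!: eventually_mono)
  qed
  \<comment> \<open>Since \<open>w\<close> is positive everywhere, it can vanish a.e. on
    \<open>?A\<close> only if \<open>?A\<close> is a null set.\<close>
  with AE_space show ?thesis
    by eventually_elim (use pos in \<open>auto simp: less_top less_imp_neq[symmetric]\<close>)
qed

theorem proposition3p1:
  fixes M :: "'a measure" and \<phi> :: "'a \<Rightarrow> 'a" and h :: "'a \<Rightarrow> ennreal" and p :: real
  assumes "complete_measure M" and "sigma_finite_measure M"
    and "nonsingular M \<phi>"
    and "h \<in> borel_measurable M"
    and "AE x in M. h x = RN_deriv M (distr M M \<phi>) x"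
    and "1 \<le> p"
  shows "(densely_defined M p (comp_op M p \<phi>) \<longleftrightarrow> (AE x in M. h x < \<infinity>))
    \<and> ((AE x in M. h x < \<infinity>) \<longleftrightarrow> sigma_finite_measure (density M h))
    \<and> ((AE x in M. h x < \<infinity>) \<longrightarrow>
         Lp_closure M p (Lp (density M (\<lambda>x. 1 + h x)) p) = Lp_closure M p (dom (comp_op M p \<phi>))
       \<and> Lp_closure M p (dom (comp_op M p \<phi>)) = Lp M p)"
proof -
  interpret sigma_finite_measure M by fact
  note basic = assms(2-5)
  have "(AE x in M. h x < \<infinity>) \<longleftrightarrow> Lp_closure M p (comp_domain M p \<phi>) = Lp M p"
    using comp_domain_dense[OF basic assms(6)] comp_domain_dense_imp_finite[OF basic assms(6)]
    by blast
  \<comment> \<open>Over a \<sigma>-finite base measure, a density yields a \<sigma>-finite measure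
    exactly when it is finite a.e.\<close>
  moreover have "(AE x in M. h x < \<infinity>) \<longleftrightarrow> sigma_finite_measure (density M h)"
    using sigma_finite_iff_density_finite[OF assms(4)] by (simp add: less_top)
  ultimately show ?thesis
    using Lp_density_eq_comp_domain[OF basic, of p] comp_domain_subset[of M p \<phi>]
    by (simp add: densely_defined_def dom_comp_op)
qed

end
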